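(* Let $\mathbb{L}\in\{\mathbb{R},\mathbb{C}\}$, $n,k\ge1$, and let $\mathbf{P}^{(k)}=[\mathbf{p}_1\cdots\mathbf{p}_k]\in\mathbb{L}^{n\times k}$ be a random matrix whose columns $\mathbf{p}_1,\dots,\mathbf{p}_k$ are independent and uniformly distributed unit vectors in $\mathbb{L}^n$ (i.e., $\mathbf{P}^{(k)}$ is uniformly distributed in $\mathcal{M}^{(k)}_{n,1}(\mathbb{L})$). Let $\mathbf{H}\in\mathbb{L}^{n\times k}$ have i.i.d. Gaussian entries with zero mean and unit variance. Then for any constant $c>0$, \[ \mathrm{E}_{\mathbf{H}}\left[\log\left|\mathbf{I}_k+\frac{c}{n}\mathbf{H}^{\dagger}\mathbf{H}\right|\right]\le \mathrm{E}\left[\log\left|\mathbf{I}_k+c\,\mathbf{P}^{(k)\dagger}\mathbf{P}^{(k)}\right|\right]\le \log\mathrm{E}\left[\left|\mathbf{I}_k+c\,\mathbf{P}^{(k)\dagger}\mathbf{P}^{(k)}\right|\right]. \]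
   Context: $|\cdot|$ denotes the determinant. $\mathcal{M}^{(k)}_{n,1}(\mathbb{L})$ is the set of $n\times k$ matrices whose columns are unit vectors in $\mathbb{L}^n$ (composite Grassmann matrices generating elements of the $k$-fold product of the Grassmann manifold of lines in $\mathbb{L}^n$); "uniformly distributed" means the columns are independent and each is uniformly distributed on the unit sphere of $\mathbb{L}^n$. *)

theory Defs
  imports "HOL-Probability.Probability"
begin

definition col :: "'a^'k^'n \<Rightarrow> 'k \<Rightarrow> 'a^'n" where
  "col A j = (\<chi> i. A $ i $ j)"

definition cnj_transpose :: "complex^'k^'n \<Rightarrow> complex^'n^'k" where
  "cnj_transpose A = (\<chi> i j. cnj (A $ j $ i))"

text \<open>Uniform (normalized surface) distribution on the unit sphere of a
  Euclidean space, realized as the cone measure: the push-forward of the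
  uniform distribution on the open unit ball under radial projection
  x \<mapsto> x / norm x (the origin is a null set).  For complex^'n the
  underlying real space is R^(2n).\<close>
definition unif_sphere :: "('a::euclidean_space) measure" where
  "unif_sphere = distr (uniform_measure lborel (ball 0 1)) borel (\<lambda>x. x /\<^sub>R norm x)"

text \<open>Real standard Gaussian N(0,1), and circularly-symmetric complex
  standard Gaussian CN(0,1) (zero mean, E|z|^2 = 1).\<close>
definition real_std_gaussian :: "real measure" where
  "real_std_gaussian = density lborel std_normal_density"

definition complex_std_gaussian :: "complex measure" where
  "complex_std_gaussian = density lborel (\<lambda>z. exp (- (cmod z)\<^sup>2) / pi)"

definition unif_sphere_cols ::
  "'w measure \<Rightarrow> ('w \<Rightarrow> ('a::euclidean_space)^'k^'n) \<Rightarrow> bool" where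
  "unif_sphere_cols M P \<longleftrightarrow>
     P \<in> borel_measurable M \<and>
     prob_space.indep_vars M (\<lambda>_. borel) (\<lambda>j \<omega>. col (P \<omega>) j) UNIV \<and>
     (\<forall>j. distr M borel (\<lambda>\<omega>. col (P \<omega>) j) = unif_sphere)"

definition iid_entries ::
  "'w measure \<Rightarrow> ('w \<Rightarrow> ('a::euclidean_space)^'k^'n) \<Rightarrow> 'a measure \<Rightarrow> bool" where
  "iid_entries N H G \<longleftrightarrow>
     H \<in> borel_measurable N \<and>
     prob_space.indep_vars N (\<lambda>_. borel) (\<lambda>(i,j) \<omega>. H \<omega> $ i $ j) UNIV \<and>
     (\<forall>i j. distr N borel (\<lambda>\<omega>. H \<omega> $ i $ j) = G)"

end

theory Submission
  imports Defs
begin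

text \<open>The determinant of the identity plus s times the Gram matrix of the columns
  is quadratic in the length of each single column: its value is a + r^2 q if one column
  is r p with p fixed, where a \<ge> 1 and q \<ge> 0. A Gaussian column
  is r p with r independent of p, with p uniform on the sphere and with n the mean of r^2, so
  by concavity of the logarithm replacing it by the column of length sqrt n and direction p can only
  increase the expected logarithm. Doing this for one column after the other gives the first inequality.
  The second one is Jensen's inequality.\<close>

section \<open>Gram determinants\<close>

text \<open>Concavity is applied only to the squared length of one column, with its direction and
  all other columns held fixed, so each estimate is proved for arbitrary values of the other
  columns. The bounds on a and q come without eigenvalues: positive definiteness is used only to see
  that the determinant never vanishes, and the quadratic law along a ray then excludes a decrease.
  Since the determinant is at least 1, all logarithms are nonnegative. The comparison can therefore
  run in extended nonnegative integrals, where the order of integration is free and an infinite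
  value does no harm; real integrals return at the end, through boundedness on the spherical side.
  Independence of length and direction has to be extracted from the definition of the sphere measure
  by radial projection, and it rests on the scaling of Lebesgue measure. The factor c/n compensates
  the length sqrt n of the comparison columns.\<close>

lemma det_scale_row_col:
  fixes B :: "'a::comm_ring_1^'k^'k"
  shows "\<exists>c q. \<forall>r. det (\<chi> i l. (if i = l then 1 else 0)
      + (if i = j then r else 1) * B $ i $ l * (if l = j then r else 1)) = c + r\<^sup>2 * q"
proof -
  define T where "T r i l = (if i = l then 1 else 0)
      + (if i = j then r else 1) * B $ i $ l * (if l = j then r else 1)" for r :: 'a and i l
  \<comment> \<open>Each Leibniz product is examined separately. A permutation fixing
    \<open>j\<close> meets row \<open>j\<close> and column \<open>j\<close> only in the diagonal
    entry \<open>1 + r\<^sup>2 * B $ j $ j\<close>. Any other permutation picks one off-diagonal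
    entry from row \<open>j\<close> and one from column \<open>j\<close>, where the identity
    contributes 0, so exactly two factors \<open>r\<close> come out.\<close>
  have perm_term: "\<exists>c q. \<forall>r. (\<Prod>i\<in>UNIV. T r i (p i)) = c + r\<^sup>2 * q" if p: "p permutes (UNIV :: 'k set)" for p
  proof (cases "p j = j")
    case True
    have "T r i (p i) = T 1 i (p i)" if "i \<in> UNIV - {j}" for r i
    proof -
      have "p i \<noteq> j" using that True permutes_inj[OF p] by (metis Diff_iff injD singletonI)
      then show ?thesis using that by (simp add: T_def)
    qed
    then have others: "(\<Prod>i\<in>UNIV - {j}. T r i (p i)) = (\<Prod>i\<in>UNIV - {j}. T 1 i (p i))" for r
      by (rule prod.cong[OF refl])
    have "(\<Prod>i\<in>UNIV. T r i (p i)) = T r j j * (\<Prod>i\<in>UNIV - {j}. T 1 i (p i))" for r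
      using prod.remove[of UNIV j "\<lambda>i. T r i (p i)"] others[of r] True by simp
    then have "(\<Prod>i\<in>UNIV. T r i (p i)) = (\<Prod>i\<in>UNIV - {j}. T 1 i (p i))
        + r\<^sup>2 * (B $ j $ j * (\<Prod>i\<in>UNIV - {j}. T 1 i (p i)))" for r
      by (simp add: T_def[of _ j j] algebra_simps power2_eq_square)
    then show ?thesis by blast
  next
    case False
    \<comment> \<open>The row in which the permutation picks its entry from column
      \<open>j\<close>.\<close>
    define m where "m = inv p j"
    have pm: "p i = j \<longleftrightarrow> i = m" for i
      using p unfolding m_def by (metis permutes_inv_eq)
    have "m \<noteq> j" using False pm by auto
    have factor: "T r i (p i) = (if i = j then r else 1) * (if i = m then r else 1) * T 1 i (p i)" for r i
      using False \<open>m \<noteq> j\<close> pm[of i] pm[of j] by (auto simp: T_def)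
    have "(\<Prod>i\<in>UNIV. T r i (p i)) = 0 + r\<^sup>2 * (\<Prod>i\<in>UNIV. T 1 i (p i))" for r
    proof -
      have "(\<Prod>i\<in>UNIV. T r i (p i))
          = (\<Prod>i\<in>UNIV. (if i = j then r else 1) * (if i = m then r else 1) * T 1 i (p i))"
        by (rule prod.cong[OF refl factor])
      also have "\<dots> = 0 + r\<^sup>2 * (\<Prod>i\<in>UNIV. T 1 i (p i))"
        by (simp add: prod.distrib power2_eq_square)
      finally show ?thesis .
    qed
    then show ?thesis by blast
  qed
  then obtain c q where cq: "\<And>p r. p permutes (UNIV :: 'k set) \<Longrightarrow>
      (\<Prod>i\<in>UNIV. T r i (p i)) = c p + r\<^sup>2 * q p"
    by metis
  have "det (\<chi> i l. T r i l) = (\<Sum>p | p permutes (UNIV :: 'k set). of_int (sign p) * c p)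
      + r\<^sup>2 * (\<Sum>p | p permutes (UNIV :: 'k set). of_int (sign p) * q p)" for r
    by (simp add: det_def cq algebra_simps sum.distrib sum_distrib_left)
  then show ?thesis unfolding T_def by blast
qed

lemma continuous_on_det:
  fixes A :: "'b::topological_space \<Rightarrow> 'a::real_normed_field^'k^'k"
  assumes "continuous_on S A"
  shows "continuous_on S (\<lambda>x. det (A x))"
  unfolding det_def by (intro continuous_intros assms)

text \<open>The axioms hold for the real numbers with the identity and the complex numbers with
  conjugation, so that both cases of the theorem are treated at once.\<close>
locale conj_field =
  fixes cj :: "'a::{real_normed_field,euclidean_space} \<Rightarrow> 'a" and re :: "'a \<Rightarrow> real"
  assumes cj_add: "cj (x + y) = cj x + cj y"
    and cj_mult: "cj (x * y) = cj x * cj y"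
    and cj_cj: "cj (cj x) = x"
    and cj_of_real: "cj (of_real r) = of_real r"
    and cj_mult_self: "cj x * x = of_real ((norm x)\<^sup>2)"
    and continuous_on_cj: "continuous_on UNIV cj"
    and cj_fixed: "cj x = x \<Longrightarrow> of_real (re x) = x"
    and bounded_linear_re: "bounded_linear re"
    and re_of_real: "re (of_real r) = r"
begin

text \<open>The columns form a function rather than a matrix, so that replacing one column is a
  function update and their joint law is a measure on \<open>PiM\<close>. For
  \<open>x = col A\<close> this is the conjugate transpose of \<open>A\<close> times
  \<open>A\<close>.\<close>

definition gram :: "('k::finite \<Rightarrow> 'a^'n) \<Rightarrow> 'a^'k^'k" where
  "gram x = (\<chi> i j. \<Sum>l\<in>UNIV. cj (x i $ l) * x j $ l)"

definition gdet :: "real \<Rightarrow> ('k::finite \<Rightarrow> 'a^'n) \<Rightarrow> 'a" where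
  "gdet s x = det (mat 1 + s *\<^sub>R gram x)"

definition rdet :: "real \<Rightarrow> ('k::finite \<Rightarrow> 'a^'n) \<Rightarrow> real" where
  "rdet s x = re (gdet s x)"

lemma cj_zero: "cj 0 = 0" and cj_one: "cj 1 = 1"
  using cj_of_real[of 0] cj_of_real[of 1] by simp_all

lemma cj_sum: "cj (sum f A) = (\<Sum>x\<in>A. cj (f x))"
  by (induction A rule: infinite_finite_induct) (simp_all add: cj_zero cj_add)

lemma cj_prod: "cj (prod f A) = (\<Prod>x\<in>A. cj (f x))"
  by (induction A rule: infinite_finite_induct) (simp_all add: cj_one cj_mult)

lemma cj_scaleR: "cj (r *\<^sub>R x) = r *\<^sub>R cj x"
  by (simp add: scaleR_conv_of_real cj_mult cj_of_real)

lemma det_cj: "det (\<chi> i j. cj (A $ i $ j)) = cj (det A)" for A :: "'a^'k^'k"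
proof -
  have "cj (of_int m) = of_int m" for m
    using cj_of_real[of "of_int m"] by simp
  then show ?thesis by (simp add: det_def cj_sum cj_mult cj_prod)
qed

text \<open>The Gram matrix is Hermitian: conjugating its entries amounts to transposing it, which
  preserves the determinant. Hence \<open>gdet\<close> is real and \<open>rdet\<close> retains all
  of it.\<close>

lemma of_real_rdet: "of_real (rdet s x) = gdet s x"
proof -
  have "cj (gdet s x) = gdet s x"
    unfolding gdet_def det_cj[symmetric]
    by (subst (2) det_transpose[symmetric], rule arg_cong[where f = det])
      (simp add: gram_def vec_eq_iff transpose_def mat_def cj_add cj_scaleR cj_sum cj_mult cj_cj
        cj_zero cj_one mult.commute eq_commute)
  then show ?thesis unfolding rdet_def by (rule cj_fixed)
qed

text \<open>Positive definiteness: if v lies in the kernel, pairing the kernel equation with v gives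
  |v|^2 + s |Xv|^2 = 0, where X has the columns \<open>x j\<close>, and so v = 0.\<close>

lemma gdet_nonzero:
  fixes x :: "'k::finite \<Rightarrow> 'a^'n"
  assumes "s \<ge> 0"
  shows "gdet s x \<noteq> 0"
proof -
  have "v = 0" if v: "(mat 1 + s *\<^sub>R gram x) *v v = 0" for v :: "'a^'k"
  proof -
    \<comment> \<open>The image of \<open>v\<close> under the matrix with columns
      \<open>x j\<close>.\<close>
    define w where "w l = (\<Sum>j\<in>UNIV. x j $ l * v $ j)" for l
    have gv: "(gram x *v v) $ i = (\<Sum>l\<in>UNIV. cj (x i $ l) * w l)" for i
      unfolding w_def matrix_vector_mult_def gram_def
      by (simp add: sum_distrib_left sum_distrib_right mult.assoc) (rule sum.swap)
    have "v + s *\<^sub>R (gram x *v v) = 0"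
      using v by (simp add: matrix_vector_mult_add_rdistrib)
        (simp add: vec_eq_iff matrix_vector_mult_def scaleR_sum_right)
    then have "v $ i + s *\<^sub>R (\<Sum>l\<in>UNIV. cj (x i $ l) * w l) = 0" for i
      by (metis gv vector_add_component vector_scaleR_component zero_index)
    then have "0 = (\<Sum>i\<in>UNIV. cj (v $ i) * (v $ i + s *\<^sub>R (\<Sum>l\<in>UNIV. cj (x i $ l) * w l)))"
      by simp
    also have "\<dots> = (\<Sum>i\<in>UNIV. cj (v $ i) * v $ i)
        + s *\<^sub>R (\<Sum>i\<in>UNIV. \<Sum>l\<in>UNIV. cj (x i $ l * v $ i) * w l)"
      by (simp add: algebra_simps sum.distrib cj_mult sum_distrib_left scaleR_sum_right)
    also have "(\<Sum>i\<in>UNIV. \<Sum>l\<in>UNIV. cj (x i $ l * v $ i) * w l) = (\<Sum>l\<in>UNIV. cj (w l) * w l)"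
      by (subst sum.swap) (simp add: w_def cj_sum sum_distrib_right)
    finally have "of_real ((\<Sum>i\<in>UNIV. (norm (v $ i))\<^sup>2) + s * (\<Sum>l\<in>UNIV. (norm (w l))\<^sup>2)) = (0 :: 'a)"
      by (simp only: cj_mult_self of_real_add of_real_sum of_real_mult scaleR_conv_of_real)
    then have "(\<Sum>i\<in>UNIV. (norm (v $ i))\<^sup>2) + s * (\<Sum>l\<in>UNIV. (norm (w l))\<^sup>2) = 0"
      by (simp only: of_real_eq_0_iff)
    moreover have "s * (\<Sum>l\<in>UNIV. (norm (w l))\<^sup>2) \<ge> 0"
      using assms by (intro mult_nonneg_nonneg sum_nonneg) auto
    moreover have "(\<Sum>i\<in>UNIV. (norm (v $ i))\<^sup>2) \<ge> 0"
      by (intro sum_nonneg) auto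
    ultimately have "(\<Sum>i\<in>UNIV. (norm (v $ i))\<^sup>2) = 0" by linarith
    then show "v = 0" by (simp add: sum_nonneg_eq_0_iff vec_eq_iff)
  qed
  then have "invertible (mat 1 + s *\<^sub>R gram x)"
    using matrix_left_invertible_ker invertible_left_inverse by blast
  then show ?thesis by (simp add: gdet_def invertible_det_nz)
qed

lemma rdet_nonzero: "s \<ge> 0 \<Longrightarrow> rdet s x \<noteq> 0"
  using gdet_nonzero[of s x] of_real_rdet[of s x] by auto

lemma rdet_scale_column:
  "rdet s (x(j := r *\<^sub>R y)) = rdet s (x(j := 0)) + r\<^sup>2 * (rdet s (x(j := y)) - rdet s (x(j := 0)))"
proof -
  define B where "B = s *\<^sub>R gram (x(j := y))"
  have "mat 1 + s *\<^sub>R gram (x(j := r *\<^sub>R y)) = (\<chi> i l. (if i = l then 1 else 0)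
      + (if i = j then of_real r else 1) * B $ i $ l * (if l = j then of_real r else 1))" for r
    by (auto simp: B_def gram_def mat_def vec_eq_iff cj_scaleR scaleR_conv_of_real[of _ "_ :: 'a"]
        sum_distrib_left sum_distrib_right algebra_simps cj_mult cj_of_real intro!: sum.cong)
  moreover obtain c q where "\<And>r. det (\<chi> i l. (if i = l then 1 else 0)
      + (if i = j then r else 1) * B $ i $ l * (if l = j then r else 1)) = c + r\<^sup>2 * q"
    using det_scale_row_col[of j B] by metis
  ultimately have *: "gdet s (x(j := r *\<^sub>R y)) = c + (of_real r)\<^sup>2 * q" for r
    by (simp add: gdet_def)
  have "of_real (rdet s (x(j := r *\<^sub>R y))) = (of_real (rdet s (x(j := 0))
      + r\<^sup>2 * (rdet s (x(j := y)) - rdet s (x(j := 0)))) :: 'a)"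
    \<comment> \<open>The unknown coefficients are read off at two radii: radius 0 gives
      \<open>c\<close> and radius 1 gives \<open>c + q\<close>.\<close>
    using *[of r] *[of 0] *[of 1] by (simp add: of_real_rdet)
  then show ?thesis by (simp only: of_real_eq_iff)
qed

text \<open>A negative increment would, by the quadratic scaling law, make the determinant vanish for
  a suitable multiple of the column.\<close>
lemma rdet_zero_column_le:
  assumes "s \<ge> 0" and pos: "rdet s (x(j := 0)) > 0"
  shows "rdet s (x(j := 0)) \<le> rdet s (x(j := y))"
proof (rule ccontr)
  define a b where "a = rdet s (x(j := 0))" and "b = rdet s (x(j := y)) - a"
  assume "\<not> ?thesis"
  then have b: "b < 0" by (simp add: a_def b_def)
  define r where "r = sqrt (a / - b)"
  have "r\<^sup>2 = a / - b" using pos b by (simp add: r_def a_def divide_nonneg_neg)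
  then have "rdet s (x(j := r *\<^sub>R y)) = 0"
    using b unfolding rdet_scale_column[of s x j r y] by (simp add: a_def[symmetric] b_def[symmetric])
  then show False using rdet_nonzero assms by blast
qed

text \<open>Induction over a set containing all nonzero columns: with no columns the determinant is
  1, and inserting a column cannot lower it. The induction hypothesis supplies the positivity that
  \<open>rdet_zero_column_le\<close> asks for.\<close>

lemma rdet_ge_1:
  fixes x :: "'k::finite \<Rightarrow> 'a^'n"
  assumes "s \<ge> 0"
  shows "rdet s x \<ge> 1"
proof -
  have "\<forall>x :: 'k \<Rightarrow> 'a^'n. (\<forall>i. i \<notin> J \<longrightarrow> x i = 0) \<longrightarrow> rdet s x \<ge> 1" if "finite J" for J
    using that
  proof induction
    case empty
    have "gram (\<lambda>_ :: 'k. 0 :: 'a^'n) = 0" by (simp add: gram_def vec_eq_iff)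
    then have "rdet s (\<lambda>_ :: 'k. 0 :: 'a^'n) = 1"
      using re_of_real[of 1] by (simp add: rdet_def gdet_def)
    moreover have "x = (\<lambda>_. 0)" if "\<forall>i. i \<notin> {} \<longrightarrow> x i = 0" for x :: "'k \<Rightarrow> 'a^'n"
      using that by (intro ext) simp
    ultimately show ?case by (metis order_refl)
  next
    case (insert j J)
    show ?case
    proof safe
      fix x :: "'k \<Rightarrow> 'a^'n" assume x: "\<forall>i. i \<notin> insert j J \<longrightarrow> x i = 0"
      then have 1: "rdet s (x(j := 0)) \<ge> 1" using insert by auto
      then have "rdet s (x(j := 0)) \<le> rdet s (x(j := x j))"
        by (intro rdet_zero_column_le assms) auto
      then show "rdet s x \<ge> 1" using 1 by simp
    qed
  qed
  from this[of UNIV] show ?thesis by simp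
qed

text \<open>Used with \<open>r = sqrt n\<close> to turn the constant c/n of the Gaussian side into
  the constant c of the spherical side.\<close>

lemma rdet_scaleR_columns: "rdet s (\<lambda>j. r *\<^sub>R x j) = rdet (s * r\<^sup>2) x"
proof -
  have "s *\<^sub>R gram (\<lambda>j. r *\<^sub>R x j) = (s * r\<^sup>2) *\<^sub>R gram x"
    by (simp add: gram_def vec_eq_iff cj_scaleR power2_eq_square scaleR_sum_right)
  then show ?thesis by (simp add: rdet_def gdet_def)
qed

lemma continuous_on_gdet:
  assumes "\<And>j. continuous_on S (\<lambda>w. x w j)"
  shows "continuous_on S (\<lambda>w. gdet s (x w))"
proof -
  have "continuous_on S (\<lambda>w. cj (x w i $ l))" for i l
    by (rule continuous_on_compose2[OF continuous_on_cj]) (intro continuous_intros assms, simp)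
  then have "continuous_on S (\<lambda>w. mat 1 + s *\<^sub>R gram (x w))"
    unfolding gram_def by (intro continuous_intros assms)
  then show ?thesis unfolding gdet_def by (rule continuous_on_det)
qed

end

section \<open>Polar decomposition of radial densities\<close>

text \<open>Finiteness is required only on initial intervals, because the radial image of Lebesgue
  measure, to which this is applied, can have infinite total mass.\<close>

lemma measure_eqI_lessThan_real:
  fixes M N :: "real measure"
  assumes "sets M = sets borel" "sets N = sets borel"
    and eq: "\<And>s. emeasure M {..<s} = emeasure N {..<s}"
    and fin: "\<And>s. emeasure M {..<s} \<noteq> \<infinity>"
  shows "M = N"
proof (rule measure_eqI_generator_eq[where E = "range lessThan" and \<Omega> = UNIV and A = "\<lambda>n. {..<real n}"])
  show "Int_stable (range (lessThan :: real \<Rightarrow> _))"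
  proof -
    have "{..<a} \<inter> {..<b} = {..<min a b}" for a b :: real by auto
    then show ?thesis by (auto simp: Int_stable_def)
  qed
  show "(\<Union>i. {..<real i}) = UNIV"
    by (auto simp: reals_Archimedean2)
  have "sets borel = sigma_sets UNIV (range (lessThan :: real \<Rightarrow> _))"
    unfolding borel_Iio by (rule sets_measure_of) auto
  then show "sets M = sigma_sets UNIV (range lessThan)" "sets N = sigma_sets UNIV (range lessThan)"
    using assms by simp_all
qed (use eq fin in auto)

lemma emeasure_distr_density:
  assumes [measurable]: "f \<in> borel_measurable M" "h \<in> measurable M N" "A \<in> sets N"
  shows "emeasure (distr (density M f) N h) A = (\<integral>\<^sup>+x. f x * indicator A (h x) \<partial>M)"
proof -
  have "emeasure (distr (density M f) N h) A = (\<integral>\<^sup>+x. indicator A x \<partial>distr (density M f) N h)"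
    by simp
  also have "\<dots> = (\<integral>\<^sup>+x. f x * indicator A (h x) \<partial>M)"
    by (subst nn_integral_distr) (simp_all add: nn_integral_density)
  finally show ?thesis .
qed

lemma nn_integral_lborel_scaleR:
  fixes f :: "'a::euclidean_space \<Rightarrow> ennreal"
  assumes [measurable]: "f \<in> borel_measurable borel" and c: "c > 0"
  shows "(\<integral>\<^sup>+x. f x \<partial>lborel) = ennreal (c ^ DIM('a)) * (\<integral>\<^sup>+x. f (c *\<^sub>R x) \<partial>lborel)"
  using c by (subst lborel_affine[of c 0])
    (simp_all add: nn_integral_density nn_integral_distr nn_integral_cmult)

lemma nn_integral_unif_sphere:
  fixes g :: "'a::euclidean_space \<Rightarrow> ennreal"
  assumes [measurable]: "g \<in> borel_measurable borel"
  shows "(\<integral>\<^sup>+x. g x \<partial>unif_sphere) =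
    (\<integral>\<^sup>+x. g (sgn x) * indicator (ball 0 1) x \<partial>lborel) / emeasure lborel (ball (0 :: 'a) 1)"
  unfolding unif_sphere_def sgn_div_norm[symmetric]
  by (simp add: nn_integral_distr nn_integral_uniform_measure)

lemma emeasure_lborel_unit_ball:
  "emeasure lborel (ball (0::'a::euclidean_space) 1) \<noteq> 0"
  "emeasure lborel (ball (0::'a::euclidean_space) 1) < \<infinity>"
  using emeasure_lborel_ball_finite[of "0::'a" 1] content_ball_pos[of 1 "0::'a"]
  by (auto simp: emeasure_eq_ennreal_measure)

lemma prob_space_unif_sphere: "prob_space (unif_sphere :: 'a::euclidean_space measure)"
  unfolding unif_sphere_def sgn_div_norm[symmetric]
  by (intro prob_space.prob_space_distr prob_space_uniform_measure)
    (use emeasure_lborel_unit_ball[where 'a='a] in auto)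

lemma sets_unif_sphere [measurable_cong]: "sets unif_sphere = sets borel"
  by (simp add: unif_sphere_def)

text \<open>As measures in the set of radii, both sides give the interval below s a mass proportional to
  the power of s with exponent DIM.\<close>
lemma nn_integral_polar_indicator:
  fixes A :: "'a::euclidean_space set" and \<psi> :: "real \<Rightarrow> ennreal"
  assumes [measurable]: "A \<in> sets borel" "\<psi> \<in> borel_measurable borel"
  shows "(\<integral>\<^sup>+x. indicator A (sgn x) * \<psi> (norm x) \<partial>lborel) =
    emeasure unif_sphere A * (\<integral>\<^sup>+x. \<psi> (norm (x :: 'a)) \<partial>lborel)"
proof -
  define \<mu> where "\<mu> C = distr (density lborel (\<lambda>x::'a. indicator C (sgn x))) borel norm" for C :: "'a set"
  define v where "v = emeasure lborel (ball (0 :: 'a) 1)"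
  have v: "v \<noteq> 0" "v < \<infinity>" unfolding v_def by (rule emeasure_lborel_unit_ball)+
  have small: "emeasure (\<mu> C) {..<s} = (if s > 0 then ennreal (s ^ DIM('a)) * (v * emeasure unif_sphere C) else 0)"
    if [measurable]: "C \<in> sets borel" for C s
  proof -
    have "emeasure (\<mu> C) {..<s} = (\<integral>\<^sup>+x. indicator C (sgn x) * indicator {..<s} (norm x) \<partial>lborel)"
      by (simp add: \<mu>_def emeasure_distr_density)
    also have "\<dots> = (if s > 0 then ennreal (s ^ DIM('a)) * (v * emeasure unif_sphere C) else 0)"
    proof (cases "s > 0")
      case True
      \<comment> \<open>Scaling by \<open>s\<close> carries the unit ball to the ball of radius
        \<open>s\<close> and leaves directions unchanged.\<close>
      have "(\<integral>\<^sup>+x. indicator C (sgn x) * indicator {..<s} (norm x) \<partial>lborel) =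
        ennreal (s ^ DIM('a)) * (\<integral>\<^sup>+(x::'a). indicator C (sgn (s *\<^sub>R x)) * indicator {..<s} (norm (s *\<^sub>R x)) \<partial>lborel)"
        by (rule nn_integral_lborel_scaleR) (use True in auto)
      also have "(\<integral>\<^sup>+(x::'a). indicator C (sgn (s *\<^sub>R x)) * indicator {..<s} (norm (s *\<^sub>R x)) \<partial>lborel)
        = (\<integral>\<^sup>+(x::'a). indicator C (sgn x) * indicator (ball 0 1) x \<partial>lborel)"
        using True by (intro nn_integral_cong) (auto simp: sgn_scaleR indicator_def)
      also have "\<dots> = v * (\<integral>\<^sup>+x. indicator C x \<partial>unif_sphere)"
        using ennreal_mult_divide_eq[of v] v by (subst nn_integral_unif_sphere)
          (auto simp: v_def[symmetric] ennreal_times_divide mult.commute[of v])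
      finally show ?thesis using True by (simp add: sets_unif_sphere)
    next
      case False
      then have "(\<integral>\<^sup>+x. indicator C (sgn x) * indicator {..<s} (norm x) \<partial>lborel) = (\<integral>\<^sup>+(x::'a). 0 \<partial>lborel)"
        by (intro nn_integral_cong) (auto simp: indicator_def dest: le_less_trans[OF norm_ge_zero])
      then show ?thesis using False by simp
    qed
    finally show ?thesis .
  qed
  interpret U: prob_space "unif_sphere :: 'a measure" by (rule prob_space_unif_sphere)
  have "space unif_sphere = (UNIV :: 'a set)" by (simp add: unif_sphere_def)
  then have [simp]: "emeasure (unif_sphere :: 'a measure) UNIV = 1" using U.emeasure_space_1 by simp
  \<comment> \<open>The whole sphere has mass 1, so \<open>\<mu> UNIV\<close> is the unrestricted
    radial measure; restricting the directions to \<open>A\<close> only multiplies it by a constant.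
    That is the independence of radius and direction.\<close>
  have eq: "\<mu> A = scale_measure (emeasure unif_sphere A) (\<mu> UNIV)"
  proof (rule measure_eqI_lessThan_real)
    fix s
    show "emeasure (\<mu> A) {..<s} = emeasure (scale_measure (emeasure unif_sphere A) (\<mu> UNIV)) {..<s}"
      by (simp add: small mult_ac)
    show "emeasure (\<mu> A) {..<s} \<noteq> \<infinity>"
      using v U.emeasure_finite[of A] by (auto simp: small ennreal_mult_eq_top_iff)
  qed (auto simp: \<mu>_def)
  have int: "(\<integral>\<^sup>+x. \<psi> x \<partial>\<mu> C) = (\<integral>\<^sup>+x. indicator C (sgn x) * \<psi> (norm x) \<partial>lborel)"
    if [measurable]: "C \<in> sets borel" for C
    by (simp add: \<mu>_def nn_integral_distr nn_integral_density)
  have "\<psi> \<in> borel_measurable (\<mu> UNIV)" by (simp add: \<mu>_def)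
  then show ?thesis using int[of A] int[of UNIV] by (simp add: eq nn_integral_scale_measure)
qed

text \<open>Restates the product formula as an identity of measures, so that it passes from
  indicators of directions to arbitrary nonnegative functions of the direction.\<close>

lemma distr_sgn_radial_density:
  fixes \<psi> :: "real \<Rightarrow> ennreal"
  assumes [measurable]: "\<psi> \<in> borel_measurable borel"
  shows "distr (density lborel (\<lambda>x::'a::euclidean_space. \<psi> (norm x))) borel sgn
    = scale_measure (\<integral>\<^sup>+x. \<psi> (norm (x :: 'a)) \<partial>lborel) unif_sphere" (is "?L = ?R")
proof (rule measure_eqI)
  fix A assume "A \<in> sets ?L"
  then have [measurable]: "A \<in> sets borel" by simp
  show "emeasure ?L A = emeasure ?R A"
    using nn_integral_polar_indicator[of A \<psi>] by (simp add: emeasure_distr_density mult.commute)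
qed (simp add: sets_unif_sphere)

lemma nn_integral_polar:
  fixes \<psi> :: "real \<Rightarrow> ennreal" and g :: "'a::euclidean_space \<Rightarrow> ennreal"
  assumes [measurable]: "\<psi> \<in> borel_measurable borel" "g \<in> borel_measurable borel"
  shows "(\<integral>\<^sup>+x. \<psi> (norm x) * g (sgn x) \<partial>lborel)
    = (\<integral>\<^sup>+x. \<psi> (norm (x :: 'a)) \<partial>lborel) * (\<integral>\<^sup>+x. g x \<partial>unif_sphere)"
proof -
  have "(\<integral>\<^sup>+x. \<psi> (norm x) * g (sgn x) \<partial>lborel) =
      (\<integral>\<^sup>+x. g x \<partial>distr (density lborel (\<lambda>x::'a. \<psi> (norm x))) borel sgn)"
    by (simp add: nn_integral_distr nn_integral_density)
  also have "\<dots> = (\<integral>\<^sup>+x. \<psi> (norm (x :: 'a)) \<partial>lborel) * (\<integral>\<^sup>+x. g x \<partial>unif_sphere)"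
    unfolding distr_sgn_radial_density[OF assms(1)]
    by (rule nn_integral_scale_measure) (simp add: measurable_cong_sets[OF sets_unif_sphere refl])
  finally show ?thesis .
qed

section \<open>Gaussian vectors and product measures\<close>

text \<open>The tangent of the logarithm at the value attained at radius sqrt m dominates
  the integrand; it is affine in the squared radius, which is independent of the direction
  and has mean m.\<close>
lemma nn_integral_ln_radial_le_sphere:
  fixes \<phi> :: "real \<Rightarrow> ennreal" and h :: "'a::euclidean_space \<Rightarrow> real"
  assumes [measurable]: "\<phi> \<in> borel_measurable borel" "h \<in> borel_measurable borel"
    and mass: "(\<integral>\<^sup>+x. \<phi> (norm (x :: 'a)) \<partial>lborel) = 1"
    and moment: "(\<integral>\<^sup>+x. \<phi> (norm (x :: 'a)) * ennreal ((norm x)\<^sup>2) \<partial>lborel) = ennreal m"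
    and m: "m > 0" and \<alpha>: "\<alpha> \<ge> 1"
    and quadratic: "\<And>r x. h (r *\<^sub>R x) = \<alpha> + r\<^sup>2 * (h x - \<alpha>)"
    and ge: "\<And>x. h x \<ge> \<alpha>"
  shows "(\<integral>\<^sup>+x. ennreal (ln (h x)) \<partial>density lborel (\<lambda>x. \<phi> (norm x)))
    \<le> (\<integral>\<^sup>+x. ennreal (ln (h (sqrt m *\<^sub>R x))) \<partial>unif_sphere)"
proof -
  define L where "L p = ennreal (ln (h (sqrt m *\<^sub>R p)))" for p
  \<comment> \<open>With Y the value at radius \<open>sqrt m\<close>, the tangent of the logarithm
    at Y has increment (h x - Y) / Y, which equals g (r^2 / m - 1). This fixes the slope
    \<open>g\<close>, which lies between 0 and 1.\<close>
  define g where "g p = (h (sqrt m *\<^sub>R p) - \<alpha>) / h (sqrt m *\<^sub>R p)" for p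
  have [measurable]: "L \<in> borel_measurable borel" "g \<in> borel_measurable borel"
    unfolding L_def g_def by measurable
  have hpos: "h x \<ge> 1" for x using ge[of x] \<alpha> by simp
  have g01: "0 \<le> g p" "g p \<le> 1" for p
    using ge[of "sqrt m *\<^sub>R p"] hpos[of "sqrt m *\<^sub>R p"] \<alpha> by (auto simp: g_def)
  \<comment> \<open>The tangent inequality with its negative term \<open>- g\<close> moved to the
    left, so that every term is nonnegative and can be integrated in \<open>ennreal\<close>.\<close>
  have real_ineq: "ln (h x) + g (sgn x) \<le> ln (h (sqrt m *\<^sub>R sgn x)) + g (sgn x) * ((norm x)\<^sup>2 / m)" for x
  proof -
    define Q where "Q = h (sgn x) - \<alpha>"
    define Y where "Y = h (sqrt m *\<^sub>R sgn x)"
    have Y: "Y = \<alpha> + m * Q" using m unfolding Y_def quadratic[of "sqrt m"] Q_def by simp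
    have hx: "h x = \<alpha> + (norm x)\<^sup>2 * Q"
      \<comment> \<open>The origin is separate because \<open>sgn 0 = 0\<close>; there both sides
        equal \<open>\<alpha>\<close>.\<close>
      using quadratic[of "norm x" "sgn x"] by (cases "x = 0") (simp_all add: Q_def sgn_div_norm)
    have Y1: "Y \<ge> 1" unfolding Y_def by (rule hpos)
    have "ln (h x / Y) \<le> h x / Y - 1" using hpos[of x] Y1 by (intro ln_le_minus_one) auto
    then have "ln (h x) \<le> ln Y + (h x - Y) / Y"
      using hpos[of x] Y1 by (simp add: ln_div diff_divide_distrib)
    also have "(h x - Y) / Y = g (sgn x) * ((norm x)\<^sup>2 / m) - g (sgn x)"
    proof -
      have "g (sgn x) = m * Q / Y" by (simp add: g_def Y_def[symmetric] Y)
      then have "g (sgn x) * ((norm x)\<^sup>2 / m) - g (sgn x) = Q * ((norm x)\<^sup>2 - m) / Y"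
        using m by (simp add: diff_divide_distrib right_diff_distrib)
      also have "\<dots> = (h x - Y) / Y" by (simp add: hx Y algebra_simps)
      finally show ?thesis by simp
    qed
    finally show ?thesis by (simp add: Y_def)
  qed
  have ln_h: "ln (h x) \<ge> 0" for x using hpos[of x] by simp
  have ineq: "ennreal (ln (h x)) + ennreal (g (sgn x))
      \<le> L (sgn x) + ennreal ((norm x)\<^sup>2) * (ennreal (1 / m) * ennreal (g (sgn x)))" for x
    using real_ineq[of x] ln_h g01[of "sgn x"] m unfolding L_def
    by (simp add: ennreal_plus[symmetric] ennreal_mult[symmetric] mult.commute del: ennreal_plus)
  define K where "K = (\<integral>\<^sup>+p. ennreal (g p) \<partial>(unif_sphere :: 'a measure))"
  interpret U: prob_space "unif_sphere :: 'a measure" by (rule prob_space_unif_sphere)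
  have "K \<le> (\<integral>\<^sup>+p. 1 \<partial>(unif_sphere :: 'a measure))"
    unfolding K_def by (intro nn_integral_mono) (use g01 in auto)
  \<comment> \<open>Finiteness permits cancelling \<open>K\<close> from both sides at the
    end.\<close>
  then have "K \<noteq> \<top>" using U.emeasure_space_1 by (auto simp: top_unique)
  have "(\<integral>\<^sup>+x. \<phi> (norm x) * ennreal (ln (h x)) \<partial>lborel) + K
     = (\<integral>\<^sup>+x. \<phi> (norm x) * ennreal (ln (h x)) \<partial>lborel) + (\<integral>\<^sup>+x. \<phi> (norm x) * ennreal (g (sgn x)) \<partial>lborel)"
    unfolding K_def by (subst nn_integral_polar) (simp_all add: mass)
  also have "\<dots> = (\<integral>\<^sup>+x. \<phi> (norm x) * (ennreal (ln (h x)) + ennreal (g (sgn x))) \<partial>lborel)"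
    by (simp add: nn_integral_add distrib_left)
  also have "\<dots> \<le> (\<integral>\<^sup>+x. \<phi> (norm x) *
      (L (sgn x) + ennreal ((norm x)\<^sup>2) * (ennreal (1 / m) * ennreal (g (sgn x)))) \<partial>lborel)"
    by (intro nn_integral_mono mult_left_mono ineq) auto
  also have "\<dots> = (\<integral>\<^sup>+x. \<phi> (norm x) * L (sgn x) \<partial>lborel)
      + (\<integral>\<^sup>+x. (\<phi> (norm x) * ennreal ((norm x)\<^sup>2)) * (ennreal (1 / m) * ennreal (g (sgn x))) \<partial>lborel)"
    by (simp add: nn_integral_add distrib_left mult.assoc)
  also have "(\<integral>\<^sup>+x. \<phi> (norm x) * L (sgn x) \<partial>lborel) = (\<integral>\<^sup>+p. L p \<partial>unif_sphere)"
    by (subst nn_integral_polar) (simp_all add: mass)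
  also have "(\<integral>\<^sup>+x. (\<phi> (norm x) * ennreal ((norm x)\<^sup>2)) * (ennreal (1 / m) * ennreal (g (sgn x))) \<partial>lborel)
      = ennreal m * (\<integral>\<^sup>+p. ennreal (1 / m) * ennreal (g p) \<partial>unif_sphere)"
    using nn_integral_polar[of "\<lambda>r. \<phi> r * ennreal (r\<^sup>2)" "\<lambda>p. ennreal (1 / m) * ennreal (g p)"]
    by (simp add: moment)
  \<comment> \<open>The second moment \<open>m\<close> cancels \<open>1 / m\<close>: on average the
    linear term is exactly the \<open>K\<close> added on the left.\<close>
  also have "\<dots> = K"
  proof -
    have "(\<integral>\<^sup>+p. ennreal (1 / m) * ennreal (g p) \<partial>unif_sphere) = ennreal (1 / m) * K"
      unfolding K_def by (rule nn_integral_cmult) (simp add: measurable_cong_sets[OF sets_unif_sphere refl])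
    then show ?thesis using m by (simp add: mult.assoc[symmetric] ennreal_mult[symmetric])
  qed
  finally have "(\<integral>\<^sup>+x. \<phi> (norm x) * ennreal (ln (h x)) \<partial>lborel) \<le> (\<integral>\<^sup>+p. L p \<partial>unif_sphere)"
    using \<open>K \<noteq> \<top>\<close> by (simp add: add.commute[of _ K] ennreal_add_left_cancel_le)
  then show ?thesis by (simp add: nn_integral_density L_def)
qed

text \<open>A hybrid argument: the factors are exchanged one by one. It works because the
  one-coordinate inequality is assumed for every choice of the remaining coordinates, whichever of
  the two measures they are later integrated against.\<close>

lemma nn_integral_PiM_mono_coordinatewise:
  fixes A B :: "'b measure" and F :: "('i \<Rightarrow> 'b) \<Rightarrow> ennreal"
  assumes "finite I" and A: "sigma_finite_measure A" and B: "sigma_finite_measure B"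
    and sets_eq: "sets A = sets B"
    and "F \<in> borel_measurable (PiM I (\<lambda>_. A))"
    and "\<And>i x. i \<in> I \<Longrightarrow> x \<in> space (PiM (I - {i}) (\<lambda>_. A)) \<Longrightarrow>
      (\<integral>\<^sup>+y. F (x(i := y)) \<partial>A) \<le> (\<integral>\<^sup>+y. F (x(i := y)) \<partial>B)"
  shows "(\<integral>\<^sup>+x. F x \<partial>PiM I (\<lambda>_. A)) \<le> (\<integral>\<^sup>+x. F x \<partial>PiM I (\<lambda>_. B))"
  using assms(1,5,6)
proof (induction arbitrary: F)
  case empty
  have "PiM ({} :: 'i set) (\<lambda>_. A) = PiM {} (\<lambda>_. B)" by (simp add: PiM_empty)
  then show ?case by simp
next
  case (insert i I)
  interpret A: sigma_finite_measure A by fact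
  interpret B: sigma_finite_measure B by fact
  interpret PA: product_sigma_finite "\<lambda>_. A" ..
  interpret PB: product_sigma_finite "\<lambda>_. B" ..
  note sets_eq [measurable_cong]
  have sp: "space A = space B" using sets_eq by (rule sets_eq_imp_space_eq)
  have setsP: "sets (PiM J (\<lambda>_. A)) = sets (PiM J (\<lambda>_. B))" for J :: "'i set"
    by (intro sets_PiM_cong) (simp_all add: sets_eq)
  have FA [measurable]: "F \<in> borel_measurable (PiM (insert i I) (\<lambda>_. A))" by (rule insert.prems)
  then have FB: "F \<in> borel_measurable (PiM (insert i I) (\<lambda>_. B))"
    by (simp add: measurable_cong_sets[OF setsP refl])
  \<comment> \<open>The new coordinate is already integrated against \<open>B\<close>; the induction
    hypothesis then exchanges the other factors.\<close>
  define F' where "F' x = (\<integral>\<^sup>+y. F (x(i := y)) \<partial>B)" for x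
  have F' [measurable]: "F' \<in> borel_measurable (PiM I (\<lambda>_. A))"
    unfolding F'_def by measurable
  have "(\<integral>\<^sup>+x. F x \<partial>PiM (insert i I) (\<lambda>_. A)) = (\<integral>\<^sup>+x. \<integral>\<^sup>+y. F (x(i := y)) \<partial>A \<partial>PiM I (\<lambda>_. A))"
    by (rule PA.product_nn_integral_insert) (use insert.hyps FA in auto)
  also have "\<dots> \<le> (\<integral>\<^sup>+x. F' x \<partial>PiM I (\<lambda>_. A))"
    unfolding F'_def using insert.hyps by (intro nn_integral_mono insert.prems) auto
  also have "\<dots> \<le> (\<integral>\<^sup>+x. F' x \<partial>PiM I (\<lambda>_. B))"
  proof (rule insert.IH[OF F'])
    fix j x assume j: "j \<in> I" and x: "x \<in> space (PiM (I - {j}) (\<lambda>_. A))"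
    have ij: "i \<noteq> j" using j insert.hyps by auto
    \<comment> \<open>Fubini moves the integral over coordinate \<open>j\<close> inside, where the
      assumption on \<open>F\<close> applies with coordinate \<open>i\<close> fixed. It is used for
      \<open>C = A\<close> and for \<open>C = B\<close>.\<close>
    have swap: "(\<integral>\<^sup>+z. F' (x(j := z)) \<partial>C) = (\<integral>\<^sup>+y. \<integral>\<^sup>+z. F (x(i := y, j := z)) \<partial>C \<partial>B)"
      if "sigma_finite_measure C" and [measurable_cong]: "sets C = sets A" for C
    proof -
      interpret C: sigma_finite_measure C by fact
      interpret CB: pair_sigma_finite C B ..
      have "(\<lambda>p. (x(j := fst p))(i := snd p)) \<in> measurable (C \<Otimes>\<^sub>M B) (PiM (insert i I) (\<lambda>_. A))"
      proof (rule measurable_fun_upd)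
        show "(\<lambda>p. x(j := fst p)) \<in> measurable (C \<Otimes>\<^sub>M B) (PiM I (\<lambda>_. A))"
          by (rule measurable_fun_upd[where J = "I - {j}"]) (use j x in auto)
      qed auto
      then have [measurable]: "(\<lambda>p. F ((x(j := fst p))(i := snd p))) \<in> borel_measurable (C \<Otimes>\<^sub>M B)"
        by measurable
      have "(\<integral>\<^sup>+z. F' (x(j := z)) \<partial>C) = (\<integral>\<^sup>+y. \<integral>\<^sup>+z. F (x(j := z, i := y)) \<partial>C \<partial>B)"
        unfolding F'_def by (rule CB.Fubini'[symmetric]) (simp add: case_prod_beta')
      then show ?thesis using ij by (simp add: fun_upd_twist)
    qed
    have "(\<integral>\<^sup>+y. \<integral>\<^sup>+z. F (x(i := y, j := z)) \<partial>A \<partial>B) \<le> (\<integral>\<^sup>+y. \<integral>\<^sup>+z. F (x(i := y, j := z)) \<partial>B \<partial>B)"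
      using j x ij insert.hyps
      by (intro nn_integral_mono insert.prems) (auto simp: space_PiM sp PiE_iff extensional_def)
    then show "(\<integral>\<^sup>+z. F' (x(j := z)) \<partial>A) \<le> (\<integral>\<^sup>+z. F' (x(j := z)) \<partial>B)"
      using A B sets_eq by (simp add: swap)
  qed
  also have "\<dots> = (\<integral>\<^sup>+x. F x \<partial>PiM (insert i I) (\<lambda>_. B))"
    unfolding F'_def by (rule PB.product_nn_integral_insert[symmetric]) (use insert.hyps FB in auto)
  finally show ?case .
qed

section \<open>Densities of vectors with independent entries\<close>

text \<open>Lebesgue measure is determined by its values on boxes; a box of vectors is a product of
  boxes, and the basis vectors are the \<open>axis i b\<close>.\<close>

lemma lborel_vec:
  "(lborel :: ('a::euclidean_space^'n) measure) = distr (PiM UNIV (\<lambda>_. lborel)) borel vec_lambda"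
proof (rule lborel_eqI)
  interpret product_sigma_finite "\<lambda>_ :: 'n. lborel :: 'a measure" ..
  have [measurable]: "vec_lambda \<in> measurable (PiM UNIV (\<lambda>_. lborel)) (borel :: ('a^'n) measure)"
    by (rule borel_measurable_euclidean_space[THEN iffD2]) (auto simp: Basis_vec_def inner_axis)
  fix l u :: "'a^'n"
  assume lu: "\<And>b. b \<in> Basis \<Longrightarrow> l \<bullet> b \<le> u \<bullet> b"
  have "vec_lambda -` box l u = (\<Pi>\<^sub>E i\<in>UNIV. box (l $ i) (u $ i))"
    by (auto simp: mem_box Basis_vec_def inner_axis PiE_iff)
  then have "emeasure (distr (PiM UNIV (\<lambda>_. lborel)) borel vec_lambda) (box l u)
      = emeasure (PiM UNIV (\<lambda>_. lborel)) (\<Pi>\<^sub>E i\<in>UNIV. box (l $ i) (u $ i))"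
    by (subst emeasure_distr) (auto simp: space_PiM)
  also have "\<dots> = (\<Prod>i\<in>UNIV. emeasure lborel (box (l $ i) (u $ i)))"
    by (rule emeasure_PiM) auto
  also have "\<dots> = (\<Prod>i\<in>UNIV. ennreal (\<Prod>b\<in>Basis. (u $ i - l $ i) \<bullet> b))"
  proof (intro prod.cong refl emeasure_lborel_box)
    fix i b assume "b \<in> (Basis :: 'a set)"
    then show "l $ i \<bullet> b \<le> u $ i \<bullet> b" using lu[of "axis i b"] by (simp add: inner_axis)
  qed
  also have "\<dots> = ennreal (\<Prod>i\<in>UNIV. \<Prod>b\<in>Basis. (u $ i - l $ i) \<bullet> b)"
  proof (intro prod_ennreal prod_nonneg)
    fix i b assume "b \<in> (Basis :: 'a set)"
    then show "0 \<le> (u $ i - l $ i) \<bullet> b" using lu[of "axis i b"] by (simp add: inner_axis inner_diff_left)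
  qed
  also have "(\<Prod>i\<in>UNIV. \<Prod>b\<in>Basis. (u $ i - l $ i) \<bullet> b) = (\<Prod>(i, b)\<in>UNIV \<times> Basis. (u - l) \<bullet> axis i b)"
    by (simp add: prod.cartesian_product inner_axis)
  also have "\<dots> = (\<Prod>b\<in>Basis. (u - l) \<bullet> b)"
  proof -
    have "bij_betw (\<lambda>(i, b). axis i b) (UNIV \<times> Basis) (Basis :: ('a^'n) set)"
      by (auto simp: bij_betw_def inj_on_def axis_eq_axis Basis_vec_def nonzero_Basis image_iff)
    from prod.reindex_bij_betw[OF this, of "\<lambda>b. (u - l) \<bullet> b"] show ?thesis
      by (simp add: case_prod_beta')
  qed
  finally show "emeasure (distr (PiM UNIV (\<lambda>_. lborel)) borel vec_lambda) (box l u)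
      = ennreal (\<Prod>b\<in>Basis. (u - l) \<bullet> b)" .
qed simp

lemma PiM_density:
  fixes f :: "'b \<Rightarrow> ennreal"
  assumes "finite I" "sigma_finite_measure M" "sigma_finite_measure (density M f)"
    and [measurable]: "f \<in> borel_measurable M"
  shows "PiM I (\<lambda>_. density M f) = density (PiM I (\<lambda>_. M)) (\<lambda>x. \<Prod>i\<in>I. f (x i))"
proof -
  interpret M: sigma_finite_measure M by fact
  interpret D: sigma_finite_measure "density M f" by fact
  interpret PM: product_sigma_finite "\<lambda>_. M" ..
  interpret PD: product_sigma_finite "\<lambda>_. density M f" ..
  show ?thesis
  proof (rule PD.PiM_eqI[OF assms(1), symmetric])
    show "sets (density (PiM I (\<lambda>_. M)) (\<lambda>x. \<Prod>i\<in>I. f (x i))) = sets (PiM I (\<lambda>_. density M f))"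
      by (simp, intro sets_PiM_cong) auto
    fix A assume "\<And>i. i \<in> I \<Longrightarrow> A i \<in> sets (density M f)"
    then have A [measurable]: "\<And>i. i \<in> I \<Longrightarrow> A i \<in> sets M" by simp
    have "emeasure (density (PiM I (\<lambda>_. M)) (\<lambda>x. \<Prod>i\<in>I. f (x i))) (Pi\<^sub>E I A)
        = (\<integral>\<^sup>+x. (\<Prod>i\<in>I. f (x i)) * indicator (Pi\<^sub>E I A) x \<partial>PiM I (\<lambda>_. M))"
      using A assms(1) by (intro emeasure_density) (auto intro: sets_PiM_I_finite)
    also have "\<dots> = (\<integral>\<^sup>+x. (\<Prod>i\<in>I. f (x i) * indicator (A i) (x i)) \<partial>PiM I (\<lambda>_. M))"
      using assms(1) by (intro nn_integral_cong)
        (auto simp: prod.distrib indicator_def space_PiM PiE_iff prod_zero_iff)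
    also have "\<dots> = (\<Prod>i\<in>I. \<integral>\<^sup>+x. f x * indicator (A i) x \<partial>M)"
      by (rule PM.product_nn_integral_prod) (use assms(1) in auto)
    also have "\<dots> = (\<Prod>i\<in>I. emeasure (density M f) (A i))"
      by (intro prod.cong) (auto simp: emeasure_density)
    finally show "emeasure (density (PiM I (\<lambda>_. M)) (\<lambda>x. \<Prod>i\<in>I. f (x i))) (Pi\<^sub>E I A)
        = (\<Prod>i\<in>I. emeasure (density M f) (A i))" .
  qed
qed

lemma (in prob_space) distr_indep_eq_PiM:
  fixes X :: "'i::finite \<Rightarrow> 'a \<Rightarrow> 'b::topological_space"
  assumes "indep_vars (\<lambda>_. borel) X UNIV" and "\<And>i. distr M borel (X i) = D"
  shows "distr M (PiM UNIV (\<lambda>_. borel)) (\<lambda>\<omega> i. X i \<omega>) = PiM UNIV (\<lambda>_. D)"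
proof -
  have "random_variable borel (X i)" for i using assms(1) by (simp add: indep_vars_def)
  then show ?thesis
    using indep_vars_iff_distr_eq_PiM[where I = UNIV and M' = "\<lambda>_. borel" and X = X] assms by (simp add: restrict_UNIV)
qed

text \<open>Independence describes the law on functions as a product measure with product density;
  \<open>vec_lambda\<close> then carries it to vectors.\<close>

lemma (in prob_space) distr_vec_density:
  fixes X :: "'n::finite \<Rightarrow> 'a \<Rightarrow> 'b::euclidean_space" and f :: "'b \<Rightarrow> ennreal"
  assumes ind: "indep_vars (\<lambda>_. borel) X UNIV" and D: "\<And>i. distr M borel (X i) = density lborel f"
    and [measurable]: "f \<in> borel_measurable borel"
  shows "distr M borel (\<lambda>\<omega>. \<chi> i. X i \<omega>) = density lborel (\<lambda>v. \<Prod>i\<in>UNIV. f (v $ i))"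
proof -
  have [measurable]: "random_variable borel (X i)" for i using ind by (simp add: indep_vars_def)
  have [measurable]: "(\<lambda>v :: 'b^'n. v $ i) \<in> borel_measurable borel" for i
    by (intro borel_measurable_continuous_onI continuous_intros)
  have vec: "vec_lambda \<in> measurable (PiM UNIV (\<lambda>_. borel)) (borel :: ('b^'n) measure)"
    by (rule borel_measurable_euclidean_space[THEN iffD2]) (auto simp: Basis_vec_def inner_axis)
  then have [measurable]: "vec_lambda \<in> measurable (PiM UNIV (\<lambda>_. lborel)) (borel :: ('b^'n) measure)"
    by (simp cong: measurable_cong_sets)
  interpret D: prob_space "density lborel f" using prob_space_distr[of "X undefined" borel] by (simp add: D)
  have "distr M borel (\<lambda>\<omega>. \<chi> i. X i \<omega>)
      = distr (distr M (PiM UNIV (\<lambda>_. borel)) (\<lambda>\<omega> i. X i \<omega>)) borel vec_lambda"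
    using measurable_restrict[of UNIV X M "\<lambda>_. borel"]
    by (subst distr_distr) (auto simp: comp_def vec restrict_UNIV)
  also have "\<dots> = distr (density (PiM UNIV (\<lambda>_. lborel)) (\<lambda>x. \<Prod>i\<in>UNIV. f (x i))) borel vec_lambda"
    unfolding distr_indep_eq_PiM[OF ind D]
    by (subst PiM_density) (auto intro: D.sigma_finite_measure_axioms sigma_finite_lborel)
  also have "\<dots> = density (distr (PiM UNIV (\<lambda>_. lborel)) borel vec_lambda) (\<lambda>v. \<Prod>i\<in>UNIV. f (v $ i))"
    by (subst density_distr) auto
  finally show ?thesis unfolding lborel_vec[symmetric] .
qed

section \<open>Random matrices\<close>

lemma col_measurable [measurable]:
  "(\<lambda>A :: 'a::euclidean_space^'k^'n. col A j) \<in> borel_measurable borel"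
  unfolding col_def by (intro borel_measurable_continuous_onI continuous_intros)

context conj_field
begin

text \<open>Over a finite index set the product sigma-algebra is the Borel one of the product
  topology, so continuity suffices.\<close>

lemma rdet_measurable [measurable]:
  "(\<lambda>x :: 'k::finite \<Rightarrow> 'a^'n. rdet s x) \<in> borel_measurable (PiM UNIV (\<lambda>_. borel))"
proof -
  have "continuous_on UNIV (\<lambda>x :: 'k \<Rightarrow> 'a^'n. rdet s x)"
    unfolding rdet_def
    by (intro bounded_linear.continuous_on[OF bounded_linear_re] continuous_on_gdet
        continuous_on_product_coordinates)
  then show ?thesis
    using sets_PiM_equal_borel[where 'a = 'k and 'b = "'a^'n"]
    by (simp add: borel_measurable_continuous_onI cong: measurable_cong_sets)
qed

lemma nn_integral_ln_rdet_le_sphere: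
  fixes \<phi> :: "real \<Rightarrow> ennreal"
  defines "A \<equiv> density lborel (\<lambda>x :: 'a^'n. \<phi> (norm x))"
  assumes [measurable]: "\<phi> \<in> borel_measurable borel"
    and mass: "(\<integral>\<^sup>+x. \<phi> (norm (x :: 'a^'n)) \<partial>lborel) = 1"
    and moment: "(\<integral>\<^sup>+x. \<phi> (norm (x :: 'a^'n)) * ennreal ((norm x)\<^sup>2) \<partial>lborel) = ennreal m"
    and m: "m > 0" and s: "s \<ge> 0"
  shows "(\<integral>\<^sup>+x. ennreal (ln (rdet s x)) \<partial>PiM (UNIV :: 'k::finite set) (\<lambda>_. A))
    \<le> (\<integral>\<^sup>+x. ennreal (ln (rdet s x)) \<partial>PiM (UNIV :: 'k set) (\<lambda>_. distr unif_sphere borel (\<lambda>p :: 'a^'n. sqrt m *\<^sub>R p)))"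
proof (rule nn_integral_PiM_mono_coordinatewise)
  note sets_unif_sphere [measurable_cong]
  have [measurable]: "(\<lambda>p :: 'a^'n. sqrt m *\<^sub>R p) \<in> measurable unif_sphere borel" by measurable
  have "prob_space A"
    by rule (use mass in \<open>simp add: A_def emeasure_density\<close>)
  then show "sigma_finite_measure A"
    by (simp add: prob_space_imp_sigma_finite)
  have "prob_space (distr unif_sphere borel (\<lambda>p :: 'a^'n. sqrt m *\<^sub>R p))"
    by (intro prob_space.prob_space_distr prob_space_unif_sphere) auto
  then show "sigma_finite_measure (distr unif_sphere borel (\<lambda>p :: 'a^'n. sqrt m *\<^sub>R p))"
    by (simp add: prob_space_imp_sigma_finite)
  have setsA [measurable_cong]: "sets A = sets borel" by (simp add: A_def)
  have [simp]: "sets (PiM UNIV (\<lambda>_ :: 'k. A)) = sets (PiM UNIV (\<lambda>_ :: 'k. borel))"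
    by (intro sets_PiM_cong) (auto simp: setsA)
  show "(\<lambda>x. ennreal (ln (rdet s x))) \<in> borel_measurable (PiM (UNIV :: 'k set) (\<lambda>_. A))"
    by measurable
  fix j and x :: "'k \<Rightarrow> 'a^'n"
  have "(\<lambda>y i. if i = j then y else x i) \<in> measurable borel (PiM UNIV (\<lambda>_. borel))"
    using measurable_restrict[of UNIV "\<lambda>i y. if i = j then y else x i" borel "\<lambda>_. borel"]
    by (simp add: restrict_UNIV)
  then have [measurable]: "(\<lambda>y. x(j := y)) \<in> measurable borel (PiM UNIV (\<lambda>_. borel))"
    by (simp add: fun_upd_def)
  have "(\<integral>\<^sup>+y. ennreal (ln (rdet s (x(j := y)))) \<partial>A)
    \<le> (\<integral>\<^sup>+p. ennreal (ln (rdet s (x(j := sqrt m *\<^sub>R p)))) \<partial>unif_sphere)"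
    unfolding A_def
  \<comment> \<open>The constant term \<open>\<alpha>\<close> is the determinant with column
    \<open>j\<close> deleted, that is \<open>rdet s (x(j := 0))\<close>.\<close>
  proof (rule nn_integral_ln_radial_le_sphere[OF _ _ mass moment m])
    show 1: "rdet s (x(j := 0)) \<ge> 1" by (rule rdet_ge_1[OF s])
    show "rdet s (x(j := 0)) \<le> rdet s (x(j := y))" for y
      using 1 by (intro rdet_zero_column_le s) auto
  qed (measurable, rule rdet_scale_column)
  then show "(\<integral>\<^sup>+y. ennreal (ln (rdet s (x(j := y)))) \<partial>A)
    \<le> (\<integral>\<^sup>+y. ennreal (ln (rdet s (x(j := y)))) \<partial>distr unif_sphere borel (\<lambda>p. sqrt m *\<^sub>R p))"
    by (simp add: nn_integral_distr)
qed (simp_all add: A_def)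

section \<open>Integrability for uniform columns and Jensen's inequality\<close>

lemma gdet_measurable [measurable]:
  "(\<lambda>A :: 'a^'k^'n. gdet s (col A)) \<in> borel_measurable borel"
  unfolding col_def
  by (intro borel_measurable_continuous_onI continuous_on_gdet continuous_intros)

lemma rdet_col_measurable [measurable]:
  "(\<lambda>A :: 'a^'k^'n. rdet s (col A)) \<in> borel_measurable borel"
  unfolding rdet_def col_def
  by (intro borel_measurable_continuous_onI bounded_linear.continuous_on[OF bounded_linear_re]
      continuous_on_gdet continuous_intros)

text \<open>Almost surely the matrix stays in a fixed compact ball, on which the continuous
  determinant is bounded. The logarithm is then bounded too, since it lies between 0 and
  \<open>rdet - 1\<close>.\<close>

lemma unif_sphere_cols_integrable:
  fixes P :: "'w \<Rightarrow> 'a^'k^'n"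
  assumes "prob_space M" "unif_sphere_cols M P" and s: "s \<ge> 0"
  shows "integrable M (\<lambda>\<omega>. gdet s (col (P \<omega>)))"
    and "integrable M (\<lambda>\<omega>. rdet s (col (P \<omega>)))"
    and "integrable M (\<lambda>\<omega>. ln (rdet s (col (P \<omega>))))"
proof -
  interpret prob_space M by fact
  have P [measurable]: "P \<in> borel_measurable M"
    and distr: "distr M borel (\<lambda>\<omega>. col (P \<omega>) j) = unif_sphere" for j
    using assms(2) by (auto simp: unif_sphere_cols_def)
  \<comment> \<open>The inequality, unlike equality, also holds at the origin, where
    \<open>sgn\<close> is 0.\<close>
  have "AE x in unif_sphere. norm (x :: 'a^'n) \<le> 1"
    unfolding unif_sphere_def sgn_div_norm[symmetric] by (subst AE_distr_iff) (auto simp: norm_sgn)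
  then have "AE \<omega> in M. norm (col (P \<omega>) j) \<le> 1" for j
    unfolding distr[of j, symmetric] by (subst (asm) AE_distr_iff) auto
  then have "AE \<omega> in M. \<forall>j. norm (col (P \<omega>) j) \<le> 1"
    by (subst AE_all_countable) auto
  then have ball: "AE \<omega> in M. P \<omega> \<in> cball 0 (real (CARD('n) * CARD('k)))"
  proof eventually_elim
    case (elim \<omega>)
    have "norm (P \<omega>) \<le> (\<Sum>i\<in>UNIV. norm (P \<omega> $ i))"
      unfolding norm_vec_def[of "P \<omega>"] by (rule L2_set_le_sum) auto
    also have "\<dots> \<le> (\<Sum>i\<in>(UNIV :: 'n set). \<Sum>j\<in>(UNIV :: 'k set). 1)"
    proof (intro sum_mono)
      fix i
      have "norm (P \<omega> $ i) \<le> (\<Sum>j\<in>UNIV. norm (P \<omega> $ i $ j))"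
        unfolding norm_vec_def[of "P \<omega> $ i"] by (rule L2_set_le_sum) auto
      also have "\<dots> \<le> (\<Sum>j\<in>(UNIV :: 'k set). 1)"
      proof (intro sum_mono)
        fix j
        have "norm (P \<omega> $ i $ j) \<le> norm (col (P \<omega>) j)"
          using Finite_Cartesian_Product.norm_nth_le[of "col (P \<omega>) j" i] by (simp add: col_def)
        then show "norm (P \<omega> $ i $ j) \<le> 1" using elim by (meson order_trans)
      qed
      finally show "norm (P \<omega> $ i) \<le> (\<Sum>j\<in>(UNIV :: 'k set). 1)" .
    qed
    finally show ?case by simp
  qed
  have "compact ((\<lambda>A :: 'a^'k^'n. gdet s (col A)) ` cball 0 (real (CARD('n) * CARD('k))))"
    unfolding col_def by (intro compact_continuous_image continuous_on_gdet continuous_intros) auto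
  then obtain b where b: "\<And>A :: 'a^'k^'n. A \<in> cball 0 (real (CARD('n) * CARD('k))) \<Longrightarrow> norm (gdet s (col A)) \<le> b"
    using compact_imp_bounded bounded_iff by (metis imageI)
  have bound: "AE \<omega> in M. norm (gdet s (col (P \<omega>))) \<le> b"
    using ball by eventually_elim (rule b)
  have ge1: "rdet s (col (P \<omega>)) \<ge> 1" for \<omega> by (rule rdet_ge_1[OF s])
  have norm_rdet: "norm (gdet s (col (P \<omega>))) = rdet s (col (P \<omega>))" for \<omega>
    using ge1[of \<omega>] by (simp add: of_real_rdet[symmetric])
  show "integrable M (\<lambda>\<omega>. gdet s (col (P \<omega>)))"
    by (rule integrable_const_bound[OF bound]) measurable
  show "integrable M (\<lambda>\<omega>. rdet s (col (P \<omega>)))"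
  proof (rule integrable_const_bound)
    show "AE \<omega> in M. norm (rdet s (col (P \<omega>))) \<le> b"
      using bound by eventually_elim (metis ge1 abs_of_nonneg norm_rdet norm_ge_zero real_norm_def)
  qed measurable
  show "integrable M (\<lambda>\<omega>. ln (rdet s (col (P \<omega>))))"
  proof (rule integrable_const_bound)
    show "AE \<omega> in M. norm (ln (rdet s (col (P \<omega>)))) \<le> b"
      using bound
    proof eventually_elim
      case (elim \<omega>)
      then show ?case
        using ge1[of \<omega>] ln_le_minus_one[of "rdet s (col (P \<omega>))"] by (simp add: norm_rdet)
    qed
  qed measurable
qed

lemma unif_sphere_cols_jensen:
  fixes P :: "'w \<Rightarrow> 'a^'k^'n"
  assumes "prob_space M" "unif_sphere_cols M P" and s: "s \<ge> 0"
  shows "(\<integral>\<omega>. ln (rdet s (col (P \<omega>))) \<partial>M) \<le> ln (re (\<integral>\<omega>. gdet s (col (P \<omega>)) \<partial>M))"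
proof -
  interpret prob_space M by fact
  note int = unif_sphere_cols_integrable[OF assms]
  have "- ln (expectation (\<lambda>\<omega>. rdet s (col (P \<omega>)))) \<le> expectation (\<lambda>\<omega>. - ln (rdet s (col (P \<omega>))))"
  proof (rule jensens_inequality[where I = "{0<..}"])
    have "rdet s (col (P \<omega>)) > 0" for \<omega>
      using rdet_ge_1[OF s, of "col (P \<omega>)"] by simp
    then show "AE \<omega> in M. rdet s (col (P \<omega>)) \<in> {0<..}" by simp
    show "convex_on {0<..} (\<lambda>x. - ln x :: real)"
      using ln_concave by (simp add: concave_on_def)
  qed (use int in auto)
  \<comment> \<open>The expectation is taken of the field-valued determinant, with \<open>re\<close>
    outside; integrability of \<open>gdet\<close> allows the exchange.\<close>
  moreover have "re (\<integral>\<omega>. gdet s (col (P \<omega>)) \<partial>M) = (\<integral>\<omega>. rdet s (col (P \<omega>)) \<partial>M)"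
    unfolding rdet_def by (rule integral_bounded_linear[OF bounded_linear_re int(1), symmetric])
  ultimately show ?thesis by simp
qed

section \<open>Laws of the columns and the comparison of Gaussian with uniform columns\<close>

lemma unif_sphere_cols_distr:
  fixes P :: "'w \<Rightarrow> 'a^'k^'n"
  assumes "prob_space M" "unif_sphere_cols M P"
  shows "distr M (PiM UNIV (\<lambda>_. borel)) (\<lambda>\<omega> j. r *\<^sub>R col (P \<omega>) j)
    = PiM UNIV (\<lambda>_. distr unif_sphere borel (\<lambda>p. r *\<^sub>R p))"
proof -
  interpret prob_space M by fact
  have [measurable]: "P \<in> borel_measurable M"
    and ind: "indep_vars (\<lambda>_. borel) (\<lambda>j \<omega>. col (P \<omega>) j) UNIV"
    and distr: "distr M borel (\<lambda>\<omega>. col (P \<omega>) j) = unif_sphere" for j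
    using assms(2) by (auto simp: unif_sphere_cols_def)
  show ?thesis
  proof (rule distr_indep_eq_PiM)
    show "indep_vars (\<lambda>_. borel) (\<lambda>j \<omega>. r *\<^sub>R col (P \<omega>) j) UNIV"
      by (rule indep_vars_compose2[OF ind]) auto
    show "distr M borel (\<lambda>\<omega>. r *\<^sub>R col (P \<omega>) j) = distr unif_sphere borel (\<lambda>p. r *\<^sub>R p)" for j
      unfolding distr[of j, symmetric] by (subst distr_distr) (auto simp: comp_def)
  qed
qed

lemma iid_entries_distr:
  fixes H :: "'v \<Rightarrow> 'a^'k^'n" and f :: "'a \<Rightarrow> ennreal"
  assumes "prob_space N" "iid_entries N H (density lborel f)" and f: "f \<in> borel_measurable borel"
  shows "distr N (PiM UNIV (\<lambda>_. borel)) (\<lambda>\<omega>. col (H \<omega>))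
      = PiM UNIV (\<lambda>_. density lborel (\<lambda>v :: 'a^'n. \<Prod>i\<in>UNIV. f (v $ i)))"
    and "distr N borel (\<lambda>\<omega>. col (H \<omega>) j) = density lborel (\<lambda>v :: 'a^'n. \<Prod>i\<in>UNIV. f (v $ i))"
proof -
  interpret prob_space N by fact
  have ind: "indep_vars (\<lambda>_. borel) (\<lambda>(i,j) \<omega>. H \<omega> $ i $ j) (UNIV :: ('n \<times> 'k) set)"
    and distr: "distr N borel (\<lambda>\<omega>. H \<omega> $ i $ j) = density lborel f" for i j
    using assms(2) by (auto simp: iid_entries_def)
  have meas: "(\<lambda>x. \<chi> i. x (i, j)) \<in> measurable (PiM (UNIV \<times> {j}) (\<lambda>_. borel)) (borel :: ('a^'n) measure)" for j :: 'k
    by (rule borel_measurable_euclidean_space[THEN iffD2])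
      (auto simp: Basis_vec_def inner_axis intro!: borel_measurable_inner measurable_component_singleton)
  \<comment> \<open>Different columns use disjoint blocks of entries, so the blocks, and hence the
    columns, are independent.\<close>
  have "indep_vars (\<lambda>j. PiM (UNIV \<times> {j}) (\<lambda>_. borel))
      (\<lambda>j \<omega>. restrict (\<lambda>p. (case p of (i,j) \<Rightarrow> \<lambda>\<omega>. H \<omega> $ i $ j) \<omega>) (UNIV \<times> {j})) (UNIV :: 'k set)"
    by (rule indep_vars_restrict[OF ind]) (auto simp: disjoint_family_on_def)
  from indep_vars_compose2[OF this meas]
  have ind_col: "indep_vars (\<lambda>_. borel) (\<lambda>j \<omega>. col (H \<omega>) j) UNIV"
    by (simp add: col_def)
  show col: "distr N borel (\<lambda>\<omega>. col (H \<omega>) j) = density lborel (\<lambda>v :: 'a^'n. \<Prod>i\<in>UNIV. f (v $ i))" for j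
    unfolding col_def
  proof (rule distr_vec_density[OF _ distr f])
    \<comment> \<open>Singleton blocks reindex the entries of one column by their rows.\<close>
    have "indep_vars (\<lambda>i. PiM {(i, j)} (\<lambda>_. borel))
        (\<lambda>i \<omega>. restrict (\<lambda>p. (case p of (i,j) \<Rightarrow> \<lambda>\<omega>. H \<omega> $ i $ j) \<omega>) {(i, j)}) (UNIV :: 'n set)"
      by (rule indep_vars_restrict[OF ind]) (auto simp: disjoint_family_on_def)
    from indep_vars_compose2[OF this, of "\<lambda>i x. x (i, j)" "\<lambda>_. borel"]
    show "indep_vars (\<lambda>_. borel) (\<lambda>i \<omega>. H \<omega> $ i $ j) UNIV"
      by simp
  qed
  show "distr N (PiM UNIV (\<lambda>_. borel)) (\<lambda>\<omega>. col (H \<omega>))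
      = PiM UNIV (\<lambda>_. density lborel (\<lambda>v :: 'a^'n. \<Prod>i\<in>UNIV. f (v $ i)))"
    using distr_indep_eq_PiM[OF ind_col col] .
qed

text \<open>The shape of \<open>f\<close> covers both Gaussian laws. Its exponent is a multiple of
  the squared norm, so the density of a column is radial, and unit variance of the entries makes the
  mean squared length of a column n.\<close>

lemma gaussian_le_sphere:
  fixes P :: "'w \<Rightarrow> 'a^'k^'n" and H :: "'v \<Rightarrow> 'a^'k^'n"
  assumes M: "prob_space M" "unif_sphere_cols M P"
    and N: "prob_space N" "iid_entries N H (density lborel f)"
    and f: "\<And>z. f z = ennreal (a * exp (- b * (norm z)\<^sup>2))" and a: "a \<ge> 0"
    and var: "(\<integral>\<^sup>+z. f z * ennreal ((norm z)\<^sup>2) \<partial>lborel) = 1"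
    and c: "c > 0"
  shows "(\<integral>\<omega>. ln (rdet (c / real CARD('n)) (col (H \<omega>))) \<partial>N) \<le> (\<integral>\<omega>. ln (rdet c (col (P \<omega>))) \<partial>M)"
proof -
  interpret M: prob_space M by fact
  interpret N: prob_space N by fact
  have P [measurable]: "P \<in> borel_measurable M" using M(2) by (simp add: unif_sphere_cols_def)
  have H [measurable]: "H \<in> borel_measurable N" using N(2) by (simp add: iid_entries_def)
  define n where "n = real CARD('n)"
  have n: "n > 0" by (simp add: n_def)
  define \<phi> where "\<phi> r = ennreal (a ^ CARD('n) * exp (- b * r\<^sup>2))" for r
  have f_meas [measurable]: "f \<in> borel_measurable borel" unfolding f by measurable
  have \<phi>_meas [measurable]: "\<phi> \<in> borel_measurable borel" unfolding \<phi>_def by measurable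
  have prod_f: "(\<Prod>i\<in>UNIV. f (v $ i)) = \<phi> (norm v)" for v :: "'a^'n"
  proof -
    have "(norm v)\<^sup>2 = (\<Sum>i\<in>UNIV. (norm (v $ i))\<^sup>2)"
      by (simp add: norm_vec_def L2_set_def sum_nonneg)
    then show ?thesis
      using a by (simp add: f \<phi>_def prod_ennreal prod.distrib exp_sum[symmetric] sum_distrib_left sum_negf)
  qed
  define G where "G = density lborel (\<lambda>v :: 'a^'n. \<phi> (norm v))"
  note H_distr = iid_entries_distr[OF N f_meas, unfolded prod_f, folded G_def]
  \<comment> \<open>An arbitrary column; the mass and second moment of the radial density are read
    off from its law.\<close>
  obtain j :: 'k where True by simp
  have "prob_space G"
    unfolding H_distr(2)[of j, symmetric] by (intro N.prob_space_distr) measurable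
  then have mass: "(\<integral>\<^sup>+x. \<phi> (norm (x :: 'a^'n)) \<partial>lborel) = 1"
    using prob_space.emeasure_space_1[of G] by (simp add: G_def emeasure_density)
  have Hij [measurable]: "(\<lambda>\<omega>. H \<omega> $ i $ j) \<in> borel_measurable N" for i
    by (rule measurable_compose[OF H borel_measurable_continuous_onI]) (intro continuous_intros)
  have entry: "(\<integral>\<^sup>+\<omega>. ennreal ((norm (H \<omega> $ i $ j))\<^sup>2) \<partial>N) = 1" for i
  proof -
    have "(\<integral>\<^sup>+\<omega>. ennreal ((norm (H \<omega> $ i $ j))\<^sup>2) \<partial>N)
        = (\<integral>\<^sup>+z. ennreal ((norm z)\<^sup>2) \<partial>distr N borel (\<lambda>\<omega>. H \<omega> $ i $ j))"
      by (simp add: nn_integral_distr)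
    also have "distr N borel (\<lambda>\<omega>. H \<omega> $ i $ j) = density lborel f"
      using N(2) by (simp add: iid_entries_def)
    also have "(\<integral>\<^sup>+z. ennreal ((norm z)\<^sup>2) \<partial>density lborel f) = 1"
      using var by (subst nn_integral_density) auto
    finally show ?thesis .
  qed
  have "(\<integral>\<^sup>+x. \<phi> (norm (x :: 'a^'n)) * ennreal ((norm x)\<^sup>2) \<partial>lborel)
      = (\<integral>\<^sup>+v. ennreal ((norm v)\<^sup>2) \<partial>distr N borel (\<lambda>\<omega>. col (H \<omega>) j))"
    unfolding H_distr(2) G_def by (subst nn_integral_density) auto
  also have "\<dots> = (\<integral>\<^sup>+\<omega>. (\<Sum>i\<in>UNIV. ennreal ((norm (H \<omega> $ i $ j))\<^sup>2)) \<partial>N)"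
    by (subst nn_integral_distr) (measurable, simp add: norm_vec_def L2_set_def sum_nonneg col_def)
  also have "\<dots> = (\<Sum>i\<in>(UNIV :: 'n set). \<integral>\<^sup>+\<omega>. ennreal ((norm (H \<omega> $ i $ j))\<^sup>2) \<partial>N)"
    by (rule nn_integral_sum) measurable
  also have "\<dots> = (\<Sum>i\<in>(UNIV :: 'n set). 1)" by (simp only: entry)
  also have "\<dots> = ennreal n" by (simp add: n_def ennreal_of_nat_eq_real_of_nat)
  finally have moment: "(\<integral>\<^sup>+x. \<phi> (norm (x :: 'a^'n)) * ennreal ((norm x)\<^sup>2) \<partial>lborel) = ennreal n" .
  have ln_nonneg: "ln (rdet s x) \<ge> 0" if "s > 0" for s and x :: "'k \<Rightarrow> 'a^'n"
    using rdet_ge_1[of s x] that by simp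
  have colH [measurable]: "(\<lambda>\<omega>. col (H \<omega>)) \<in> measurable N (PiM UNIV (\<lambda>_. borel))"
    using measurable_restrict[of UNIV "\<lambda>j \<omega>. col (H \<omega>) j" N "\<lambda>_. borel"] by (simp add: restrict_UNIV)
  have colP [measurable]: "(\<lambda>\<omega> j. sqrt n *\<^sub>R col (P \<omega>) j) \<in> measurable M (PiM UNIV (\<lambda>_. borel))"
    using measurable_restrict[of UNIV "\<lambda>j \<omega>. sqrt n *\<^sub>R col (P \<omega>) j" M "\<lambda>_. borel"] by (simp add: restrict_UNIV)
  have "(\<integral>\<^sup>+\<omega>. ennreal (ln (rdet (c / n) (col (H \<omega>)))) \<partial>N)
      = (\<integral>\<^sup>+x. ennreal (ln (rdet (c / n) x)) \<partial>PiM UNIV (\<lambda>_ :: 'k. G))"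
    unfolding H_distr(1)[symmetric] by (subst nn_integral_distr) auto
  also have "\<dots> \<le> (\<integral>\<^sup>+x. ennreal (ln (rdet (c / n) x))
      \<partial>PiM UNIV (\<lambda>_ :: 'k. distr unif_sphere borel (\<lambda>p :: 'a^'n. sqrt n *\<^sub>R p)))"
    unfolding G_def using c n by (intro nn_integral_ln_rdet_le_sphere mass moment) auto
  also have "\<dots> = (\<integral>\<^sup>+\<omega>. ennreal (ln (rdet c (col (P \<omega>)))) \<partial>M)"
    unfolding unif_sphere_cols_distr[OF M, symmetric]
    using n by (subst nn_integral_distr) (auto simp: rdet_scaleR_columns)
  also have "\<dots> = ennreal (\<integral>\<omega>. ln (rdet c (col (P \<omega>))) \<partial>M)"
    using c ln_nonneg by (intro nn_integral_eq_integral unif_sphere_cols_integrable(3) M) auto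
  finally have le: "(\<integral>\<^sup>+\<omega>. ennreal (ln (rdet (c / n) (col (H \<omega>)))) \<partial>N) \<le> ennreal (\<integral>\<omega>. ln (rdet c (col (P \<omega>))) \<partial>M)" .
  \<comment> \<open>By \<open>le\<close> the nonnegative integral on the Gaussian side is finite, so
    \<open>enn2real\<close> preserves the bound.\<close>
  have "(\<integral>\<omega>. ln (rdet (c / n) (col (H \<omega>))) \<partial>N) = enn2real (\<integral>\<^sup>+\<omega>. ennreal (ln (rdet (c / n) (col (H \<omega>)))) \<partial>N)"
    by (rule integral_eq_nn_integral) (use c n ln_nonneg in auto)
  also have "\<dots> \<le> (\<integral>\<omega>. ln (rdet c (col (P \<omega>))) \<partial>M)"
    by (intro enn2real_leI le Bochner_Integration.integral_nonneg ln_nonneg c)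
  finally show ?thesis by (simp add: n_def)
qed

end

section \<open>The real and complex instances\<close>

interpretation real_conj: conj_field "\<lambda>x :: real. x" "\<lambda>x. x"
  by (rule conj_field.intro) (simp_all add: bounded_linear_ident power2_eq_square)

interpretation complex_conj: conj_field cnj Re
proof (rule conj_field.intro)
  show "cnj x * x = complex_of_real ((cmod x)\<^sup>2)" for x
    unfolding complex_norm_square by (rule mult.commute)
  show "cnj x = x \<Longrightarrow> complex_of_real (Re x) = x" for x
    by (simp add: complex_eq_iff)
qed (simp_all add: bounded_linear_Re continuous_intros)

lemma real_gdet_col: "real_conj.gdet s (col A) = det (mat 1 + s *\<^sub>R (transpose A ** A))"
  unfolding real_conj.gdet_def
  by (rule arg_cong[where f = det])
    (simp add: real_conj.gram_def vec_eq_iff col_def transpose_def matrix_matrix_mult_def)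

lemma complex_gdet_col: "complex_conj.gdet s (col A) = det (mat 1 + s *\<^sub>R (cnj_transpose A ** A))"
  unfolding complex_conj.gdet_def
  by (rule arg_cong[where f = det])
    (simp add: complex_conj.gram_def vec_eq_iff col_def cnj_transpose_def matrix_matrix_mult_def)

lemma nn_integral_normal_second_moment:
  assumes "\<sigma> > 0"
  shows "(\<integral>\<^sup>+x. ennreal (normal_density 0 \<sigma> x) * ennreal (x\<^sup>2) \<partial>lborel) = ennreal (\<sigma>\<^sup>2)"
proof -
  have "has_bochner_integral lborel (\<lambda>x. normal_density 0 \<sigma> x * x\<^sup>2) (\<sigma>\<^sup>2)"
    \<comment> \<open>The even moment with k = 1, whose general value (2k)! / ((2 / \<sigma>^2)^k
      k!) becomes \<sigma>^2.\<close>
    using normal_moment_even[OF assms, of 0 1] assms by (simp add: fact_numeral)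
  then have "(\<integral>\<^sup>+x. ennreal (normal_density 0 \<sigma> x * x\<^sup>2) \<partial>lborel) = ennreal (\<sigma>\<^sup>2)"
    by (subst nn_integral_eq_integral) (auto simp: has_bochner_integral_iff)
  then show ?thesis by (simp add: ennreal_mult)
qed

lemma nn_integral_normal_density:
  assumes "\<sigma> > 0"
  shows "(\<integral>\<^sup>+x. ennreal (normal_density \<mu> \<sigma> x) \<partial>lborel) = 1"
  using assms by (subst nn_integral_eq_integral) auto

lemma lborel_complex:
  "(lborel :: complex measure) = distr (lborel \<Otimes>\<^sub>M lborel) borel (\<lambda>(a, b). Complex a b)"
proof (rule lborel_eqI)
  have [measurable]: "(\<lambda>(a, b). Complex a b) \<in> borel_measurable (lborel \<Otimes>\<^sub>M lborel)"
    by (simp add: borel_measurable_complex_iff case_prod_beta')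
  fix l u :: complex
  assume lu: "\<And>b. b \<in> Basis \<Longrightarrow> l \<bullet> b \<le> u \<bullet> b"
  have "(\<lambda>(a, b). Complex a b) -` box l u = box (Re l) (Re u) \<times> box (Im l) (Im u)"
    by (auto simp: box_def Basis_complex_def inner_complex_def)
  then have "emeasure (distr (lborel \<Otimes>\<^sub>M lborel) borel (\<lambda>(a, b). Complex a b)) (box l u)
      = emeasure lborel (box (Re l) (Re u)) * emeasure lborel (box (Im l) (Im u))"
    by (subst emeasure_distr) (auto simp: space_pair_measure lborel.emeasure_pair_measure_Times)
  also have "\<dots> = ennreal (\<Prod>b\<in>Basis. (u - l) \<bullet> b)"
    using lu[of 1] lu[of \<i>] by (simp add: Basis_complex_def inner_complex_def ennreal_mult[symmetric])
  finally show "emeasure (distr (lborel \<Otimes>\<^sub>M lborel) borel (\<lambda>(a, b). Complex a b)) (box l u)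
      = ennreal (\<Prod>b\<in>Basis. (u - l) \<bullet> b)" .
qed simp

text \<open>Real and imaginary part are independent normal variables of variance 1/2, and the
  squared modulus adds their second moments.\<close>

lemma nn_integral_complex_gaussian_second_moment:
  "(\<integral>\<^sup>+z. ennreal (exp (- (cmod z)\<^sup>2) / pi) * ennreal ((cmod z)\<^sup>2) \<partial>lborel) = 1"
proof -
  \<comment> \<open>Variance 1/2 makes the normal density
    \<open>exp (- x\<^sup>2) / sqrt pi\<close>, so that two of them multiply to the complex
    density.\<close>
  define \<sigma> :: real where "\<sigma> = sqrt (1 / 2)"
  have \<sigma>: "\<sigma> > 0" "\<sigma>\<^sup>2 = 1 / 2" by (simp_all add: \<sigma>_def)
  define n where "n x = ennreal (normal_density 0 \<sigma> x)" for x
  define m where "m x = n x * ennreal (x\<^sup>2)" for x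
  have [measurable]: "n \<in> borel_measurable borel" "m \<in> borel_measurable borel"
    unfolding n_def m_def by measurable
  have n1: "(\<integral>\<^sup>+x. n x \<partial>lborel) = 1" unfolding n_def by (rule nn_integral_normal_density[OF \<sigma>(1)])
  have m1: "(\<integral>\<^sup>+x. m x \<partial>lborel) = ennreal (1 / 2)"
    unfolding m_def n_def nn_integral_normal_second_moment[OF \<sigma>(1)] \<sigma>(2) ..
  have [measurable]: "(\<lambda>(a, b). Complex a b) \<in> borel_measurable (lborel \<Otimes>\<^sub>M lborel)"
    by (simp add: borel_measurable_complex_iff case_prod_beta')
  have split: "ennreal (exp (- (cmod (Complex a b))\<^sup>2) / pi) * ennreal ((cmod (Complex a b))\<^sup>2)
      = m a * n b + n a * m b" for a b
  proof -
    have "normal_density 0 \<sigma> x = exp (- x\<^sup>2) / sqrt pi" for x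
      by (simp add: normal_density_def \<sigma>(2))
    then have "exp (- (cmod (Complex a b))\<^sup>2) / pi = normal_density 0 \<sigma> a * normal_density 0 \<sigma> b"
      by (simp add: cmod_power2 mult_exp_exp)
    then show ?thesis
      by (simp add: n_def m_def cmod_power2 ennreal_mult[symmetric] ennreal_plus[symmetric] algebra_simps
          del: ennreal_plus)
  qed
  have "(\<integral>\<^sup>+z. ennreal (exp (- (cmod z)\<^sup>2) / pi) * ennreal ((cmod z)\<^sup>2) \<partial>lborel)
      = (\<integral>\<^sup>+p. m (fst p) * n (snd p) + n (fst p) * m (snd p) \<partial>(lborel \<Otimes>\<^sub>M lborel))"
    by (subst lborel_complex, subst nn_integral_distr) (auto simp: split case_prod_beta')
  also have "\<dots> = (\<integral>\<^sup>+a. \<integral>\<^sup>+b. m a * n b + n a * m b \<partial>lborel \<partial>lborel)"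
    by (subst lborel.nn_integral_fst[symmetric]) auto
  also have "\<dots> = (\<integral>\<^sup>+a. m a + n a * ennreal (1 / 2) \<partial>lborel)"
    by (simp add: nn_integral_add nn_integral_cmult n1 m1)
  also have "\<dots> = ennreal (1 / 2) + ennreal (1 / 2)"
    by (simp add: nn_integral_add nn_integral_multc n1 m1)
  also have "\<dots> = ennreal (1 / 2 + 1 / 2)" by (rule ennreal_plus[symmetric]) simp_all
  finally show ?thesis by simp
qed

theorem theorem3:
  fixes c :: real
  assumes "c > 0"
  shows
   "(\<forall>(M::'w measure) (P::'w \<Rightarrow> real^'k^'n) (N::'v measure) (H::'v \<Rightarrow> real^'k^'n).
       prob_space M \<and> unif_sphere_cols M P \<and>
       prob_space N \<and> iid_entries N H real_std_gaussian \<longrightarrow>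
       (\<integral>\<omega>. ln (det (mat 1 + (c / real CARD('n)) *\<^sub>R (transpose (H \<omega>) ** H \<omega>))) \<partial>N)
         \<le> (\<integral>\<omega>. ln (det (mat 1 + c *\<^sub>R (transpose (P \<omega>) ** P \<omega>))) \<partial>M) \<and>
       (\<integral>\<omega>. ln (det (mat 1 + c *\<^sub>R (transpose (P \<omega>) ** P \<omega>))) \<partial>M)
         \<le> ln (\<integral>\<omega>. det (mat 1 + c *\<^sub>R (transpose (P \<omega>) ** P \<omega>)) \<partial>M))
  \<and>
   (\<forall>(M::'w measure) (P::'w \<Rightarrow> complex^'k^'n) (N::'v measure) (H::'v \<Rightarrow> complex^'k^'n).
       prob_space M \<and> unif_sphere_cols M P \<and>
       prob_space N \<and> iid_entries N H complex_std_gaussian \<longrightarrow>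
       (\<integral>\<omega>. ln (Re (det (mat 1 + (c / real CARD('n)) *\<^sub>R (cnj_transpose (H \<omega>) ** H \<omega>)))) \<partial>N)
         \<le> (\<integral>\<omega>. ln (Re (det (mat 1 + c *\<^sub>R (cnj_transpose (P \<omega>) ** P \<omega>)))) \<partial>M) \<and>
       (\<integral>\<omega>. ln (Re (det (mat 1 + c *\<^sub>R (cnj_transpose (P \<omega>) ** P \<omega>)))) \<partial>M)
         \<le> ln (Re (\<integral>\<omega>. det (mat 1 + c *\<^sub>R (cnj_transpose (P \<omega>) ** P \<omega>)) \<partial>M)))"
proof (intro conjI allI impI; elim conjE)
  fix M :: "'w measure" and P :: "'w \<Rightarrow> real^'k^'n" and N :: "'v measure" and H :: "'v \<Rightarrow> real^'k^'n"
  assume M: "prob_space M" "unif_sphere_cols M P"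
    and N: "prob_space N" "iid_entries N H real_std_gaussian"
  \<comment> \<open>Real case: a = 1 / sqrt (2 pi) and b = 1/2.\<close>
  have f: "ennreal (std_normal_density z) = ennreal (1 / sqrt (2 * pi) * exp (- (1 / 2) * (norm z)\<^sup>2))" for z
    by (simp add: std_normal_density_def)
  have var: "(\<integral>\<^sup>+z. ennreal (std_normal_density z) * ennreal ((norm z)\<^sup>2) \<partial>lborel) = 1"
    using nn_integral_normal_second_moment[of 1] by simp
  show "(\<integral>\<omega>. ln (det (mat 1 + (c / real CARD('n)) *\<^sub>R (transpose (H \<omega>) ** H \<omega>))) \<partial>N)
         \<le> (\<integral>\<omega>. ln (det (mat 1 + c *\<^sub>R (transpose (P \<omega>) ** P \<omega>))) \<partial>M)"
    using real_conj.gaussian_le_sphere[OF M N[unfolded real_std_gaussian_def] f _ var assms]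
    by (simp add: real_conj.rdet_def real_gdet_col)
  show "(\<integral>\<omega>. ln (det (mat 1 + c *\<^sub>R (transpose (P \<omega>) ** P \<omega>))) \<partial>M)
         \<le> ln (\<integral>\<omega>. det (mat 1 + c *\<^sub>R (transpose (P \<omega>) ** P \<omega>)) \<partial>M)"
    using real_conj.unif_sphere_cols_jensen[OF M, of c] assms
    by (simp add: real_conj.rdet_def real_gdet_col)
next
  fix M :: "'w measure" and P :: "'w \<Rightarrow> complex^'k^'n" and N :: "'v measure" and H :: "'v \<Rightarrow> complex^'k^'n"
  assume M: "prob_space M" "unif_sphere_cols M P"
    and N: "prob_space N" "iid_entries N H complex_std_gaussian"
  \<comment> \<open>Complex case: a = 1 / pi and b = 1.\<close>
  have f: "ennreal (exp (- (cmod z)\<^sup>2) / pi) = ennreal (1 / pi * exp (- 1 * (norm z)\<^sup>2))" for z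
    by simp
  show "(\<integral>\<omega>. ln (Re (det (mat 1 + (c / real CARD('n)) *\<^sub>R (cnj_transpose (H \<omega>) ** H \<omega>)))) \<partial>N)
         \<le> (\<integral>\<omega>. ln (Re (det (mat 1 + c *\<^sub>R (cnj_transpose (P \<omega>) ** P \<omega>)))) \<partial>M)"
    using complex_conj.gaussian_le_sphere[OF M N[unfolded complex_std_gaussian_def] f _
        nn_integral_complex_gaussian_second_moment assms]
    by (simp add: complex_conj.rdet_def complex_gdet_col)
  show "(\<integral>\<omega>. ln (Re (det (mat 1 + c *\<^sub>R (cnj_transpose (P \<omega>) ** P \<omega>)))) \<partial>M)
         \<le> ln (Re (\<integral>\<omega>. det (mat 1 + c *\<^sub>R (cnj_transpose (P \<omega>) ** P \<omega>)) \<partial>M))"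
    using complex_conj.unif_sphere_cols_jensen[OF M, of c] assms
    by (simp add: complex_conj.rdet_def complex_gdet_col)
qed

end
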